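(* Let $\Gamma$ be a simple strongly connected digraph with vertex set $X$, adjacency matrix $A$, diameter $D$ and distance-$i$ matrices $A_0=I,A_1=A,\ldots,A_D$. Then $\Gamma$ is a distance-regular digraph if and only if $A^\top\in\{A_0,A_1,\ldots,A_D\}$ and there exist complex scalars $r^h_{1i}$ $(0\le i,h\le D)$ such that $AA_i=\sum_{h=0}^D r^h_{1i}A_h$ for $0\le i\le D$.
   Context: $\partial(x,y)$ is the directed distance; $\Gamma^{\rightarrow}_i(x)=\{z\mid\partial(x,z)=i\}$; $(A_i)_{xy}=1$ iff $\partial(x,y)=i$. $\Gamma$ is a distance-regular digraph if there are integers $d^{\rightarrow}_{ij},d^{\leftarrow}_{ij}$ $(0\le i,j\le D)$ such that for every $x\in X$ and every $y\in\Gamma^{\rightarrow}_i(x)$: $|\Gamma^{\rightarrow}_1(y)\cap\Gamma^{\rightarrow}_j(x)|=d^{\rightarrow}_{ij}$ and $|\Gamma^{\leftarrow}_1(y)\cap\Gamma^{\rightarrow}_j(x)|=d^{\leftarrow}_{ij}$. *)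

theory Defs
  imports "HOL-Analysis.Analysis" "Graph_Theory.Graph_Theory"
begin

text \<open>
  Vertices are the elements of a finite type, so that square matrices indexed by the vertex set are
  available as \<^typ>\<open>complex^'a^'a\<close>; the matrices below are used for digraphs \<open>G\<close> with
  \<open>verts G = UNIV\<close>. The library locale \<^locale>\<open>digraph\<close> describes finite
  digraphs without loops and without parallel arcs; a pair of opposite arcs is allowed.
\<close>

text \<open>
  The length of a shortest directed walk (equivalently, path) from \<open>x\<close> to \<open>y\<close>. This is meaningful
  only if there is one, which strong connectivity guarantees.
\<close>
definition ddist :: "('a, 'b) pre_digraph \<Rightarrow> 'a \<Rightarrow> 'a \<Rightarrow> nat" where
  "ddist G x y = (LEAST n. \<exists>p. pre_digraph.awalk G x p y \<and> length p = n)"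

definition ddiameter :: "('a, 'b) pre_digraph \<Rightarrow> nat" where
  "ddiameter G = Max {ddist G x y | x y. x \<in> verts G \<and> y \<in> verts G}"

definition out_sphere :: "('a, 'b) pre_digraph \<Rightarrow> nat \<Rightarrow> 'a \<Rightarrow> 'a set" where
  "out_sphere G i x = {z \<in> verts G. ddist G x z = i}"

definition in_sphere :: "('a, 'b) pre_digraph \<Rightarrow> nat \<Rightarrow> 'a \<Rightarrow> 'a set" where
  "in_sphere G i x = {z \<in> verts G. ddist G z x = i}"

definition distance_regular_digraph :: "('a, 'b) pre_digraph \<Rightarrow> bool" where
  "distance_regular_digraph G \<longleftrightarrow>
     (\<exists>(dout :: nat \<Rightarrow> nat \<Rightarrow> int) (din :: nat \<Rightarrow> nat \<Rightarrow> int).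
        \<forall>i \<le> ddiameter G. \<forall>j \<le> ddiameter G. \<forall>x \<in> verts G. \<forall>y \<in> out_sphere G i x.
          int (card (out_sphere G 1 y \<inter> out_sphere G j x)) = dout i j \<and>
          int (card (in_sphere G 1 y \<inter> out_sphere G j x)) = din i j)"

definition adj_matrix :: "('a::finite, 'b) pre_digraph \<Rightarrow> complex^'a^'a" where
  "adj_matrix G = (\<chi> x y. if x \<rightarrow>\<^bsub>G\<^esub> y then 1 else 0)"

definition dist_matrix :: "('a::finite, 'b) pre_digraph \<Rightarrow> nat \<Rightarrow> complex^'a^'a" where
  "dist_matrix G i = (\<chi> x y. if ddist G x y = i then 1 else 0)"

text \<open>Multiplication of a matrix by a complex scalar; \<open>*\<^sub>R\<close> only covers real scalars.\<close>
definition matrix_scale :: "complex \<Rightarrow> complex^'n^'m \<Rightarrow> complex^'n^'m" (infixr "*\<^sub>C" 75) where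
  "c *\<^sub>C M = (\<chi> x y. c * M $ x $ y)"

end

theory Submission
  imports Defs
begin

unbundle no funcset_syntax

text \<open>
  Call a function of pairs of vertices distance-invariant if its value at \<open>(x, y)\<close> depends only on
  \<open>\<partial>(x,y)\<close>; the matrices with this property are exactly the span of \<open>A\<^sub>0, \<dots>, A\<^sub>D\<close>. Distance-regularity says
  that all \<open>A\<^sub>j A\<^sup>T\<close> and \<open>A\<^sub>j A\<close> lie in this span.

  If the digraph is distance-regular, then \<open>\<partial>(y,x)\<close> is determined by \<open>\<partial>(x,y)\<close>. Hence \<open>A\<^sup>T\<close> is some \<open>A\<^sub>k\<close>,
  and the entries of \<open>A A\<^sub>i\<close>, counting \<open>x \<rightarrow> z\<close> with \<open>\<partial>(z,y) = i\<close>, turn into counts of \<open>x \<rightarrow> z\<close> with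
  prescribed \<open>\<partial>(y,z)\<close>. Conversely, if left multiplication by \<open>A\<close> preserves the span, then each \<open>A\<^sub>j\<close> is a
  polynomial in \<open>A\<close>, so the span is closed under multiplication and contains \<open>A\<^sub>j A\<^sub>k\<close> and \<open>A\<^sub>j A\<^sub>1\<close>.
\<close>

section \<open>Bilinearity of matrix products\<close>

lemma matrix_diff_rdistrib:
  fixes A B :: "'a::ring_1^'n^'m" and C :: "'a^'k^'n"
  shows "(A - B) ** C = A ** C - B ** C"
  by (simp add: vec_eq_iff matrix_matrix_mult_def left_diff_distrib sum_subtractf)

lemma matrix_mult_comb_right:
  fixes B :: "complex^'n^'m" and C :: "'i \<Rightarrow> complex^'k^'n"
  shows "B ** (\<Sum>h\<in>I. c h *\<^sub>C C h) = (\<Sum>h\<in>I. c h *\<^sub>C (B ** C h))"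
proof -
  have "(\<Sum>z\<in>UNIV. B $ x $ z * (\<Sum>h\<in>I. c h * C h $ z $ y)) =
      (\<Sum>h\<in>I. c h * (\<Sum>z\<in>UNIV. B $ x $ z * C h $ z $ y))" for x y
    unfolding sum_distrib_left by (subst sum.swap) (simp add: mult_ac)
  then show ?thesis
    by (simp add: vec_eq_iff matrix_matrix_mult_def matrix_scale_def)
qed

lemma matrix_mult_comb_left:
  fixes B :: "complex^'k^'n" and C :: "'i \<Rightarrow> complex^'n^'m"
  shows "(\<Sum>h\<in>I. c h *\<^sub>C C h) ** B = (\<Sum>h\<in>I. c h *\<^sub>C (C h ** B))"
proof -
  have "(\<Sum>z\<in>UNIV. (\<Sum>h\<in>I. c h * C h $ x $ z) * B $ z $ y) =
      (\<Sum>h\<in>I. c h * (\<Sum>z\<in>UNIV. C h $ x $ z * B $ z $ y))" for x y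
    unfolding sum_distrib_left sum_distrib_right by (subst sum.swap) (simp add: mult_ac)
  then show ?thesis
    by (simp add: vec_eq_iff matrix_matrix_mult_def matrix_scale_def)
qed

section \<open>Directed distance\<close>

locale strong_digraph = digraph G for G :: "('a::finite, 'b) pre_digraph" (structure) +
  assumes verts_UNIV: "verts G = UNIV"
    and strong: "strongly_connected G"
begin

lemma ddist_le_length: "awalk x p y \<Longrightarrow> ddist G x y \<le> length p"
  unfolding ddist_def by (rule Least_le) blast

lemma ddist_awalk:
  obtains p where "awalk x p y" "length p = ddist G x y"
proof -
  have "x \<rightarrow>\<^sup>* y"
    using strong verts_UNIV by (simp add: strongly_connected_def)
  then have "\<exists>n p. awalk x p y \<and> length p = n"
    by (simp add: reachable_awalk)
  then have "\<exists>p. awalk x p y \<and> length p = ddist G x y"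
    unfolding ddist_def by (rule LeastI_ex)
  then show thesis using that by blast
qed

lemma ddist_eq_0_iff [simp]: "ddist G x y = 0 \<longleftrightarrow> x = y"
proof
  assume "ddist G x y = 0"
  then obtain p where "awalk x p y" "p = []" using ddist_awalk[of x y] by auto
  then show "x = y" by (simp add: awalk_Nil_iff)
next
  assume "x = y"
  then show "ddist G x y = 0"
    using ddist_le_length[of x "[]" y] verts_UNIV by (simp add: awalk_Nil_iff)
qed

lemma ddist_self [simp]: "ddist G x x = 0"
  by simp

lemma ddist_le_Suc:
  assumes "x \<rightarrow> y"
  shows "ddist G x z \<le> Suc (ddist G y z)"
proof -
  obtain p where p: "awalk y p z" "length p = ddist G y z" by (rule ddist_awalk)
  obtain e where "e \<in> arcs G" "tail G e = x" "head G e = y" using assms by auto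
  then have "awalk x (e # p) z" using p by (simp add: awalk_Cons_iff)
  then show ?thesis using ddist_le_length[of x "e # p" z] p by simp
qed

text \<open>\<open>y\<close> is the head of the first arc of a shortest walk. The rest of that walk
  bounds \<open>ddist G y z\<close> above by \<open>n\<close>; \<open>ddist_le_Suc\<close> bounds it
  below.\<close>

lemma ddist_SucE:
  assumes "ddist G x z = Suc n"
  obtains y where "x \<rightarrow> y" "ddist G y z = n"
proof -
  obtain p where "awalk x p z" "length p = Suc n" using assms ddist_awalk by metis
  then obtain e q where e: "e \<in> arcs G" "tail G e = x" "awalk (head G e) q z" "length q = n"
    by (auto simp: length_Suc_conv awalk_Cons_iff)
  then have dom: "x \<rightarrow> head G e" by (auto intro: in_arcs_imp_in_arcs_ends)
  then have "ddist G (head G e) z = n"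
    using ddist_le_length[OF e(3)] e(4) ddist_le_Suc[OF dom, of z] assms by simp
  with dom show thesis by (rule that)
qed

lemma ddist_eq_1_iff: "ddist G x y = Suc 0 \<longleftrightarrow> x \<rightarrow> y"
proof
  assume "ddist G x y = Suc 0"
  then show "x \<rightarrow> y" by (elim ddist_SucE) simp
next
  assume xy: "x \<rightarrow> y"
  then have "x \<noteq> y" using adj_not_same by blast
  then have "ddist G x y \<noteq> 0" by simp
  moreover have "ddist G x y \<le> Suc 0" using ddist_le_Suc[OF xy, of y] by simp
  ultimately show "ddist G x y = Suc 0" by linarith
qed

lemma ddist_le_ddiameter: "ddist G x y \<le> ddiameter G"
  unfolding ddiameter_def
proof (rule Max_ge)
  have "{ddist G x y |x y. x \<in> verts G \<and> y \<in> verts G} = (\<lambda>(x, y). ddist G x y) ` (verts G \<times> verts G)"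
    by auto
  then show "finite {ddist G x y |x y. x \<in> verts G \<and> y \<in> verts G}" by simp
qed (use verts_UNIV in auto)

lemma adj_matrix_eq: "adj_matrix G = dist_matrix G 1"
  by (simp add: adj_matrix_def dist_matrix_def ddist_eq_1_iff vec_eq_iff)

section \<open>Distance-invariant functions and matrices\<close>

definition dist_invariant :: "('a \<Rightarrow> 'a \<Rightarrow> 'c) \<Rightarrow> bool" where
  "dist_invariant f \<longleftrightarrow>
    (\<forall>x y x' y'. ddist G x y = ddist G x' y' \<longrightarrow> f x y = f x' y')"

lemma dist_invariantD: "dist_invariant f \<Longrightarrow> ddist G x y = ddist G x' y' \<Longrightarrow> f x y = f x' y'"
  unfolding dist_invariant_def by blast

lemma dist_invariant_iff: "dist_invariant f \<longleftrightarrow> (\<exists>g. \<forall>x y. f x y = g (ddist G x y))"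
proof
  assume f: "dist_invariant f"
  \<comment> \<open>If no pair has distance \<open>n\<close>, \<open>g n\<close> is arbitrary;
    \<open>g\<close> is only evaluated at distances that occur.\<close>
  define g where "g = (\<lambda>n. let w = SOME w. ddist G (fst w) (snd w) = n in f (fst w) (snd w))"
  have "f x y = g (ddist G x y)" for x y
  proof -
    let ?w = "SOME w. ddist G (fst w) (snd w) = ddist G x y"
    have "ddist G (fst ?w) (snd ?w) = ddist G x y"
      by (rule someI[of _ "(x, y)"]) simp
    from dist_invariantD[OF f this] show ?thesis unfolding g_def Let_def by (rule sym)
  qed
  then show "\<exists>g. \<forall>x y. f x y = g (ddist G x y)" by blast
qed (auto simp: dist_invariant_def)

abbreviation mat_invariant :: "complex^'a^'a \<Rightarrow> bool" where
  "mat_invariant B \<equiv> dist_invariant (\<lambda>x y. B $ x $ y)"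

lemma mat_invariant_comb:
  assumes "\<And>h. h \<in> I \<Longrightarrow> mat_invariant (B h)"
  shows "mat_invariant (\<Sum>h\<in>I. c h *\<^sub>C B h)"
  unfolding dist_invariant_def
proof (intro allI impI)
  fix x y x' y' assume "ddist G x y = ddist G x' y'"
  then have "B h $ x $ y = B h $ x' $ y'" if "h \<in> I" for h
    using dist_invariantD[OF assms[OF that]] by blast
  then show "(\<Sum>h\<in>I. c h *\<^sub>C B h) $ x $ y = (\<Sum>h\<in>I. c h *\<^sub>C B h) $ x' $ y'"
    by (simp add: matrix_scale_def cong: sum.cong)
qed

lemma mat_invariant_diff:
  assumes "mat_invariant B" "mat_invariant C"
  shows "mat_invariant (B - C)"
proof -
  obtain f g where "\<And>x y. B $ x $ y = f (ddist G x y)" "\<And>x y. C $ x $ y = g (ddist G x y)"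
    using assms unfolding dist_invariant_iff by blast
  then show ?thesis by (simp add: dist_invariant_def)
qed

lemma mat_invariant_scale_iff: "c \<noteq> 0 \<Longrightarrow> mat_invariant (c *\<^sub>C B) \<longleftrightarrow> mat_invariant B"
  by (simp add: dist_invariant_def matrix_scale_def)

text \<open>Only the summand \<open>h = ddist G x y\<close> survives, and it lies in the range
  because distances are at most the diameter.\<close>

lemma dist_comb_nth:
  "(\<Sum>h=0..ddiameter G. c h *\<^sub>C dist_matrix G h) $ x $ y = c (ddist G x y)"
  using ddist_le_ddiameter[of x y]
  by (simp add: matrix_scale_def dist_matrix_def if_distrib cong: if_cong)

lemma mat_invariant_iff:
  "mat_invariant B \<longleftrightarrow> (\<exists>c. B = (\<Sum>h=0..ddiameter G. c h *\<^sub>C dist_matrix G h))"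
proof
  assume "mat_invariant B"
  then obtain c where "\<And>x y. B $ x $ y = c (ddist G x y)"
    unfolding dist_invariant_iff by blast
  then have "B = (\<Sum>h=0..ddiameter G. c h *\<^sub>C dist_matrix G h)"
    by (simp add: vec_eq_iff dist_comb_nth del: sum_component)
  then show "\<exists>c. B = (\<Sum>h=0..ddiameter G. c h *\<^sub>C dist_matrix G h)" by blast
qed (auto simp: dist_invariant_def dist_comb_nth simp del: sum_component)

lemma mat_invariant_dist_matrix: "mat_invariant (dist_matrix G i)"
  by (simp add: dist_invariant_def dist_matrix_def)

section \<open>Products of distance matrices\<close>

lemma dist_matrix_mult_nth:
  "(dist_matrix G i ** dist_matrix G j) $ x $ y =
    of_nat (card {z. ddist G x z = i \<and> ddist G z y = j})"
proof -
  have "(dist_matrix G i ** dist_matrix G j) $ x $ y =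
      (\<Sum>z\<in>UNIV. if ddist G x z = i \<and> ddist G z y = j then 1 else 0)"
    by (auto simp: matrix_matrix_mult_def dist_matrix_def intro!: sum.cong)
  also have "\<dots> = of_nat (card {z. ddist G x z = i \<and> ddist G z y = j})"
    by (simp flip: sum.inter_filter)
  finally show ?thesis .
qed

text \<open>Solving \<open>A A\<^sub>j = \<Sum>h\<le>j+1. r h j A\<^sub>h\<close> for the last term is possible because
  \<open>r (j+1) j\<close> is a positive count.\<close>

lemma dist_matrix_Suc:
  assumes r: "adj_matrix G ** dist_matrix G j = (\<Sum>h=0..ddiameter G. r h *\<^sub>C dist_matrix G h)"
    and "ddist G u v = Suc j"
  shows "r (Suc j) \<noteq> 0"
    and "r (Suc j) *\<^sub>C dist_matrix G (Suc j) =
      adj_matrix G ** dist_matrix G j - (\<Sum>h\<le>j. r h *\<^sub>C dist_matrix G h)"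
proof -
  have count: "of_nat (card {z. x \<rightarrow> z \<and> ddist G z y = j}) = r (ddist G x y)" for x y
    using r dist_comb_nth[of r x y] dist_matrix_mult_nth[of 1 j x y]
    by (simp add: adj_matrix_eq ddist_eq_1_iff)
  obtain w where "u \<rightarrow> w" "ddist G w v = j" using assms(2) by (rule ddist_SucE)
  then have "{z. u \<rightarrow> z \<and> ddist G z v = j} \<noteq> {}" by blast
  then have "card {z. u \<rightarrow> z \<and> ddist G z v = j} \<noteq> 0" by simp
  then have "(of_nat (card {z. u \<rightarrow> z \<and> ddist G z v = j}) :: complex) \<noteq> 0"
    by (simp only: of_nat_eq_0_iff not_False_eq_True)
  then show "r (Suc j) \<noteq> 0" using count[of u v] assms(2) by simp
  \<comment> \<open>Following one arc lowers the distance to \<open>y\<close> by at most 1, so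
    beyond distance \<open>j + 1\<close> the count is empty and the expansion stops at
    \<open>h = Suc j\<close>.\<close>
  have far: "r (ddist G x y) = 0" if "Suc j < ddist G x y" for x y
  proof -
    have empty: "{z. x \<rightarrow> z \<and> ddist G z y = j} = {}"
      using that ddist_le_Suc[of x _ y] by fastforce
    show ?thesis using count[of x y] unfolding empty by simp
  qed
  have low: "(\<Sum>h\<le>j. r h *\<^sub>C dist_matrix G h) $ x $ y =
      (if ddist G x y \<le> j then r (ddist G x y) else 0)" for x y
    by (simp add: matrix_scale_def dist_matrix_def if_distrib cong: if_cong)
  have "(r (Suc j) *\<^sub>C dist_matrix G (Suc j)) $ x $ y =
      r (ddist G x y) - (if ddist G x y \<le> j then r (ddist G x y) else 0)" for x y
  proof (cases "Suc j < ddist G x y")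
    case True
    then show ?thesis using far[of x y] by (simp add: matrix_scale_def dist_matrix_def)
  next
    case False
    then have "ddist G x y \<le> j \<or> ddist G x y = Suc j" by linarith
    then show ?thesis by (auto simp: matrix_scale_def dist_matrix_def)
  qed
  then show "r (Suc j) *\<^sub>C dist_matrix G (Suc j) =
      adj_matrix G ** dist_matrix G j - (\<Sum>h\<le>j. r h *\<^sub>C dist_matrix G h)"
    unfolding vec_eq_iff vector_minus_component r dist_comb_nth low by blast
qed

text \<open>Up to a nonzero scalar, \<open>dist_matrix G (Suc k)\<close> is \<open>A A_k\<close>
  minus a combination of the \<open>A_h\<close> with \<open>h \<le> k\<close>. Multiplied by
  \<open>C\<close>, this becomes \<open>A (A_k C)\<close> minus a combination of the
  \<open>A_h C\<close>, so strong induction applies.\<close>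

lemma mat_invariant_dist_matrix_mult:
  assumes r: "\<And>i. i \<le> ddiameter G \<Longrightarrow>
      adj_matrix G ** dist_matrix G i = (\<Sum>h=0..ddiameter G. r h i *\<^sub>C dist_matrix G h)"
    and "mat_invariant C"
  shows "mat_invariant (dist_matrix G j ** C)"
  using assms(2)
proof (induction j arbitrary: C rule: less_induct)
  case (less j C)
  have adj: "mat_invariant (adj_matrix G ** B)" if "mat_invariant B" for B
  proof -
    obtain c where "B = (\<Sum>h=0..ddiameter G. c h *\<^sub>C dist_matrix G h)"
      using \<open>mat_invariant B\<close> unfolding mat_invariant_iff ..
    moreover have "mat_invariant (adj_matrix G ** dist_matrix G h)" if "h \<le> ddiameter G" for h
      unfolding r[OF that] by (intro mat_invariant_comb mat_invariant_dist_matrix)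
    ultimately show ?thesis
      by (simp only: matrix_mult_comb_right) (rule mat_invariant_comb, simp)
  qed
  show ?case
  proof (cases j)
    case 0
    have "dist_matrix G 0 = mat 1" by (simp add: dist_matrix_def mat_def)
    with 0 less.prems show ?thesis by simp
  next
    case (Suc k)
    show ?thesis
    proof (cases "\<exists>u v. ddist G u v = Suc k")
      \<comment> \<open>This covers every \<open>j\<close> above the diameter, where the hypothesis
        on \<open>r\<close> says nothing.\<close>
      case False
      then have "dist_matrix G j = 0" by (simp add: Suc dist_matrix_def vec_eq_iff)
      then show ?thesis by (simp add: dist_invariant_def matrix_matrix_mult_def)
    next
      case True
      then obtain u v where uv: "ddist G u v = Suc k" by blast
      then have "k \<le> ddiameter G" using ddist_le_ddiameter[of u v] by simp
      note rk = dist_matrix_Suc[OF r[OF this] uv]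
      let ?L = "\<Sum>h\<le>k. r h k *\<^sub>C (dist_matrix G h ** C)"
      let ?H = "adj_matrix G ** (dist_matrix G k ** C)"
      have eq: "r (Suc k) k *\<^sub>C (dist_matrix G j ** C) = ?H - ?L"
      proof -
        have "r (Suc k) k *\<^sub>C (dist_matrix G j ** C) = (r (Suc k) k *\<^sub>C dist_matrix G j) ** C"
          \<comment> \<open>A scalar multiple is a linear combination over a one-element index
            set.\<close>
          using matrix_mult_comb_left[of "\<lambda>_. r (Suc k) k" "\<lambda>_. dist_matrix G j" "{()}" C] by simp
        also have "\<dots> = ?H - ?L"
          unfolding Suc rk(2)
          by (simp add: matrix_diff_rdistrib matrix_mul_assoc matrix_mult_comb_left)
        finally show ?thesis .
      qed
      have "mat_invariant ?H" using adj less Suc by simp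
      moreover have "mat_invariant ?L" using less Suc by (intro mat_invariant_comb) auto
      ultimately have "mat_invariant (?H - ?L)" by (rule mat_invariant_diff)
      then have "mat_invariant (r (Suc k) k *\<^sub>C (dist_matrix G j ** C))" by (simp only: eq)
      then show ?thesis using rk(1) by (simp add: mat_invariant_scale_iff)
    qed
  qed
qed

section \<open>Distance-regularity as invariance of neighbour counts\<close>

lemma distance_regular_iff:
  "distance_regular_digraph G \<longleftrightarrow> (\<forall>j \<le> ddiameter G.
    dist_invariant (\<lambda>x y. card {z. y \<rightarrow> z \<and> ddist G x z = j}) \<and>
    dist_invariant (\<lambda>x y. card {z. z \<rightarrow> y \<and> ddist G x z = j}))"
    (is "_ \<longleftrightarrow> (\<forall>j \<le> _. dist_invariant (?out j) \<and> dist_invariant (?in j))")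
proof
  have out: "out_sphere G 1 y \<inter> out_sphere G j x = {z. y \<rightarrow> z \<and> ddist G x z = j}"
    and "in": "in_sphere G 1 y \<inter> out_sphere G j x = {z. z \<rightarrow> y \<and> ddist G x z = j}" for x y j
    by (auto simp: out_sphere_def in_sphere_def verts_UNIV ddist_eq_1_iff)
  {
    assume "distance_regular_digraph G"
    then obtain dout din :: "nat \<Rightarrow> nat \<Rightarrow> int" where
      d: "\<And>i j x y. \<lbrakk>i \<le> ddiameter G; j \<le> ddiameter G; y \<in> out_sphere G i x\<rbrakk> \<Longrightarrow>
        int (?out j x y) = dout i j \<and> int (?in j x y) = din i j"
      unfolding distance_regular_digraph_def out "in" verts_UNIV by blast
    have "?out j x y = nat (dout (ddist G x y) j) \<and> ?in j x y = nat (din (ddist G x y) j)"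
      if "j \<le> ddiameter G" for j x y
    proof -
      have "y \<in> out_sphere G (ddist G x y) x" by (simp add: out_sphere_def verts_UNIV)
      note eqs = d[OF ddist_le_ddiameter that this]
      show ?thesis unfolding eqs[THEN conjunct1, symmetric] eqs[THEN conjunct2, symmetric] by simp
    qed
    then show "\<forall>j \<le> ddiameter G. dist_invariant (?out j) \<and> dist_invariant (?in j)"
      by (simp add: dist_invariant_def)
  next
    assume inv: "\<forall>j \<le> ddiameter G. dist_invariant (?out j) \<and> dist_invariant (?in j)"
    have "\<forall>j\<in>{..ddiameter G}. \<exists>g. \<forall>x y. ?out j x y = g (ddist G x y)"
      using inv unfolding dist_invariant_iff by simp
    from bchoice[OF this] obtain dout where
      dout: "\<And>j x y. j \<le> ddiameter G \<Longrightarrow> ?out j x y = dout j (ddist G x y)"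
      by auto
    have "\<forall>j\<in>{..ddiameter G}. \<exists>g. \<forall>x y. ?in j x y = g (ddist G x y)"
      using inv unfolding dist_invariant_iff by simp
    from bchoice[OF this] obtain din where
      din: "\<And>j x y. j \<le> ddiameter G \<Longrightarrow> ?in j x y = din j (ddist G x y)"
      by auto
    show "distance_regular_digraph G"
      unfolding distance_regular_digraph_def out "in"
      \<comment> \<open>The chosen functions take the sphere radius \<open>j\<close> first, whereas
        the definition takes the distance \<open>i\<close> first.\<close>
      by (rule exI[of _ "\<lambda>i j. int (dout j i)"], rule exI[of _ "\<lambda>i j. int (din j i)"])
        (auto simp: out_sphere_def dout din)
  }
qed

text \<open>Whether \<open>\<partial>(y,x) \<le> n\<close> is decided by \<open>\<partial>(x,y)\<close>: a first step \<open>y \<rightarrow> z\<close> towards \<open>x\<close> can be copied at any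
  pair \<open>(x',y')\<close> at the same distance, with \<open>\<partial>(x',z') = \<partial>(x,z)\<close>.\<close>

lemma distance_regular_ddist_swap:
  assumes "distance_regular_digraph G"
  shows "dist_invariant (\<lambda>x y. ddist G y x)"
proof -
  have "ddist G y' x' \<le> n" if "ddist G y x \<le> n" "ddist G x y = ddist G x' y'" for n x y x' y'
    using that
  proof (induction n arbitrary: x y x' y')
    case 0
    then have "y = x" by simp
    with 0(2) ddist_eq_0_iff[of x x] have "x' = y'" by (metis ddist_eq_0_iff)
    then show ?case by simp
  next
    case (Suc n)
    show ?case
    proof (cases "ddist G y x = Suc n")
      case False
      with Suc.prems have "ddist G y x \<le> n" by linarith
      then show ?thesis using Suc.IH Suc.prems(2) le_SucI by blast
    next
      case True
      then obtain z where z: "y \<rightarrow> z" "ddist G z x = n" by (rule ddist_SucE)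
      have "card {w. y \<rightarrow> w \<and> ddist G x w = ddist G x z} =
          card {w. y' \<rightarrow> w \<and> ddist G x' w = ddist G x z}"
        using assms Suc.prems(2) ddist_le_ddiameter[of x z] distance_regular_iff
        unfolding dist_invariant_def by blast
      moreover have "card {w. y \<rightarrow> w \<and> ddist G x w = ddist G x z} \<noteq> 0" using z(1) by auto
      ultimately have "{w. y' \<rightarrow> w \<and> ddist G x' w = ddist G x z} \<noteq> {}" by auto
      then obtain z' where z': "y' \<rightarrow> z'" "ddist G x' z' = ddist G x z" by blast
      then have "ddist G z' x' \<le> n" using Suc.IH[of z x x' z'] z(2) by simp
      then show ?thesis using ddist_le_Suc[OF z'(1), of x'] by linarith
    qed
  qed
  \<comment> \<open>Taking \<open>n\<close> to be the reversed distance of either pair gives both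
    inequalities.\<close>
  then show ?thesis unfolding dist_invariant_def by (metis order_refl order_antisym)
qed

end

theorem theorem9p4:
  fixes G :: "('a::finite, 'b) pre_digraph"
  assumes "digraph G"
    and "verts G = UNIV"
    and "strongly_connected G"
    and "ddiameter G \<ge> 1"
  shows "distance_regular_digraph G \<longleftrightarrow>
    transpose (adj_matrix G) \<in> dist_matrix G ` {0..ddiameter G} \<and>
    (\<exists>r :: nat \<Rightarrow> nat \<Rightarrow> complex. \<forall>i \<le> ddiameter G.
       adj_matrix G ** dist_matrix G i = (\<Sum>h = 0..ddiameter G. r h i *\<^sub>C dist_matrix G h))"
proof -
  interpret strong_digraph G
    using assms(1-3) by (simp add: strong_digraph_def strong_digraph_axioms_def)
  show ?thesis
  proof (intro iffI conjI)
    assume reg: "distance_regular_digraph G"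
    note swap = dist_invariantD[OF distance_regular_ddist_swap[OF reg]]
    have "{ddist G x y |x y. x \<in> verts G \<and> y \<in> verts G} = (\<lambda>(x, y). ddist G x y) ` UNIV"
      using assms(2) by auto
    then have "ddiameter G \<in> (\<lambda>(x, y). ddist G x y) ` UNIV"
      unfolding ddiameter_def using Max_in by (metis finite finite_imageI UNIV_not_empty image_is_empty)
    then obtain a b where "ddist G a b = ddiameter G" by auto
    \<comment> \<open>A diameter of at least 1 yields an arc from \<open>a\<close> to
      \<open>u\<close>. Its return distance \<open>ddist G u a\<close> is common to all arcs by
      \<open>swap\<close>, and it serves as the index of the transpose.\<close>
    then obtain u where u: "ddist G a u = Suc 0"
      using assms(4) ddist_SucE[of a b "ddiameter G - 1"] ddist_eq_1_iff by (metis Suc_diff_1 One_nat_def Suc_le_eq)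
    have "ddist G y x = Suc 0 \<longleftrightarrow> ddist G x y = ddist G u a" for x y
      using swap u by metis
    then have "transpose (adj_matrix G) = dist_matrix G (ddist G u a)"
      by (simp add: adj_matrix_eq dist_matrix_def transpose_def)
    then show "transpose (adj_matrix G) \<in> dist_matrix G ` {0..ddiameter G}"
      using ddist_le_ddiameter by simp
    have "mat_invariant (adj_matrix G ** dist_matrix G i)" for i
      unfolding dist_invariant_def
    proof (intro allI impI)
      fix x y x' y' assume xy: "ddist G x y = ddist G x' y'"
      have "card {z. x \<rightarrow>\<^bsub>G\<^esub> z \<and> ddist G z y = i} = card {z. x' \<rightarrow>\<^bsub>G\<^esub> z \<and> ddist G z y' = i}"
      \<comment> \<open>If distance \<open>i\<close> occurs, a pair realising it translates
        \<open>ddist G z y = i\<close> into a condition on \<open>ddist G y z\<close>. The count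
        then concerns out-neighbours of \<open>x\<close> seen from \<open>y\<close>, and
        \<open>swap\<close> supplies equal distances for the reversed pairs. Otherwise both sets are
        empty.\<close>
      proof (cases "\<exists>v w. ddist G v w = i")
        case True
        then obtain v w where "ddist G v w = i" by blast
        then have i: "ddist G z y = i \<longleftrightarrow> ddist G y z = ddist G w v" for y z
          using swap by metis
        show ?thesis unfolding i
          using reg swap[OF xy] ddist_le_ddiameter[of w v] distance_regular_iff
          unfolding dist_invariant_def by blast
      qed auto
      then show "(adj_matrix G ** dist_matrix G i) $ x $ y = (adj_matrix G ** dist_matrix G i) $ x' $ y'"
        by (simp add: adj_matrix_eq dist_matrix_mult_nth ddist_eq_1_iff)
    qed
    then have c: "\<forall>i. \<exists>c. adj_matrix G ** dist_matrix G i = (\<Sum>h=0..ddiameter G. c h *\<^sub>C dist_matrix G h)"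
      unfolding mat_invariant_iff by blast
    from choice[OF c] obtain c where "\<And>i. adj_matrix G ** dist_matrix G i = (\<Sum>h=0..ddiameter G. c i h *\<^sub>C dist_matrix G h)"
      by blast
    then show "\<exists>r :: nat \<Rightarrow> nat \<Rightarrow> complex. \<forall>i \<le> ddiameter G.
       adj_matrix G ** dist_matrix G i = (\<Sum>h = 0..ddiameter G. r h i *\<^sub>C dist_matrix G h)"
      by (intro exI[of _ "\<lambda>h i. c i h"]) simp
  next
    assume asm: "transpose (adj_matrix G) \<in> dist_matrix G ` {0..ddiameter G} \<and>
      (\<exists>r :: nat \<Rightarrow> nat \<Rightarrow> complex. \<forall>i \<le> ddiameter G.
       adj_matrix G ** dist_matrix G i = (\<Sum>h = 0..ddiameter G. r h i *\<^sub>C dist_matrix G h))"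
    then obtain k where "transpose (adj_matrix G) = dist_matrix G k" by blast
    then have "(if y \<rightarrow>\<^bsub>G\<^esub> x then 1 else 0 :: complex) = (if ddist G x y = k then 1 else 0)" for x y
      by (simp add: vec_eq_iff transpose_def adj_matrix_def dist_matrix_def)
    then have k: "y \<rightarrow>\<^bsub>G\<^esub> x \<longleftrightarrow> ddist G x y = k" for x y
      by (metis zero_neq_one)
    have prod: "dist_invariant (\<lambda>x y. card {z. ddist G x z = j \<and> ddist G z y = i})" for i j
    proof -
      have "mat_invariant (dist_matrix G j ** dist_matrix G i)"
        using asm mat_invariant_dist_matrix_mult[OF _ mat_invariant_dist_matrix] by blast
      then show ?thesis unfolding dist_invariant_def dist_matrix_mult_nth of_nat_eq_iff .
    qed
    \<comment> \<open>By \<open>k\<close>, the out-neighbours \<open>z\<close> of \<open>y\<close>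
      are those with \<open>ddist G z y = k\<close>, so the two counts are the entries of
      \<open>A_j A_k\<close> and \<open>A_j A_1\<close>.\<close>
    have "dist_invariant (\<lambda>x y. card {z. y \<rightarrow>\<^bsub>G\<^esub> z \<and> ddist G x z = j})"
      "dist_invariant (\<lambda>x y. card {z. z \<rightarrow>\<^bsub>G\<^esub> y \<and> ddist G x z = j})" for j
      using prod[of j k] prod[of j "Suc 0"] by (simp_all add: k[symmetric] ddist_eq_1_iff conj_commute)
    then show "distance_regular_digraph G" by (simp add: distance_regular_iff)
  qed
qed

end
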